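(* Let $K$ be a field, $E$ a finite set, $x=\{X_e:e\in E\}$ a set of variables, and $\mathfrak P\subseteq K[x]$ a prime ideal. Let $M$ be the coordinate matroid realized by $(\mathfrak P,x)$, and let $C\subseteq E$ be a circuit of $M$. Then there is, up to multiplication with a unit in $K$, a unique polynomial $\theta_C$ such that $$\mathfrak P\cap K[X_e:e\in C]=\theta_C\cdot K[X_e:e\in C].$$
   Context: The coordinate matroid realized by $(\mathfrak P,x)$ is the matroid on $E$ whose independent sets are the $S\subseteq E$ with $\mathfrak P\cap K[X_e:e\in S]=\{0\}$; equivalently, the rank of $S$ is the Krull dimension of $K[X_e:e\in S]/(\mathfrak P\cap K[X_e:e\in S])$. A circuit is an inclusion-minimal dependent set. *)

theory Defs
  imports "HOL-Algebra.Ideal" "HOL-Library.Poly_Mapping"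
begin

text \<open>A polynomial is a finitely supported map from monomials to coefficients, a monomial being a
  finitely supported exponent vector; the type \<open>'e\<close> indexes the variables and \<open>'k\<close> is the
  coefficient field \<open>K\<close>. All the rings \<open>K[X\<^sub>e : e \<in> S]\<close> are subrings of this one type.\<close>

type_synonym ('e, 'k) mpoly = "('e \<Rightarrow>\<^sub>0 nat) \<Rightarrow>\<^sub>0 'k"

definition polys_in :: "'e set \<Rightarrow> ('e, 'k::field) mpoly set" where
  "polys_in S = {p. \<forall>m \<in> Poly_Mapping.keys p. Poly_Mapping.keys m \<subseteq> S}"

definition poly_ring :: "'e set \<Rightarrow> ('e, 'k::field) mpoly ring" where
  "poly_ring S = \<lparr>carrier = polys_in S, mult = (*), one = 1, zero = 0, add = (+)\<rparr>"

definition const :: "'k::field \<Rightarrow> ('e, 'k) mpoly" where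
  "const c = Poly_Mapping.single 0 c"

text \<open>A matroid is given by its ground set and its family of independent sets.\<close>

definition circuit :: "'e set \<times> 'e set set \<Rightarrow> 'e set \<Rightarrow> bool" where
  "circuit M C \<longleftrightarrow> C \<subseteq> fst M \<and> C \<notin> snd M \<and> (\<forall>D. D \<subset> C \<longrightarrow> D \<in> snd M)"

definition coordinate_matroid ::
    "('e, 'k::field) mpoly set \<Rightarrow> 'e set \<Rightarrow> 'e set \<times> 'e set set" where
  "coordinate_matroid P E = (E, {S. S \<subseteq> E \<and> P \<inter> polys_in S = {0}})"

lemma polys_in_plus: "p \<in> polys_in S \<Longrightarrow> q \<in> polys_in S \<Longrightarrow> p + q \<in> polys_in S"
  using Poly_Mapping.keys_add[of p q] unfolding polys_in_def by blast

lemma polys_in_uminus: "p \<in> polys_in S \<Longrightarrow> - p \<in> polys_in S"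
  unfolding polys_in_def by simp

lemma polys_in_times:
  assumes "p \<in> polys_in S" "q \<in> polys_in S"
  shows "p * q \<in> polys_in S"
proof -
  have "Poly_Mapping.keys m \<subseteq> S" if m: "m \<in> Poly_Mapping.keys (p * q)" for m
  proof -
    obtain a b where ab: "m = a + b" "a \<in> Poly_Mapping.keys p" "b \<in> Poly_Mapping.keys q"
      using m keys_mult[of p q] by blast
    then show ?thesis
      using assms Poly_Mapping.keys_add[of a b] unfolding polys_in_def by blast
  qed
  then show ?thesis unfolding polys_in_def by blast
qed

lemma polys_in_0: "0 \<in> polys_in S"
  unfolding polys_in_def by simp

lemma polys_in_1: "1 \<in> polys_in S"
  unfolding polys_in_def by (simp flip: single_one)

lemma cring_poly_ring: "cring (poly_ring S)"
proof (rule cringI)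
  show "abelian_group (poly_ring S)"
  proof (rule abelian_groupI)
    fix p assume "p \<in> carrier (poly_ring S)"
    then show "\<exists>q\<in>carrier (poly_ring S). q \<oplus>\<^bsub>poly_ring S\<^esub> p = \<zero>\<^bsub>poly_ring S\<^esub>"
      by (intro bexI[of _ "- p"]) (auto simp: poly_ring_def polys_in_uminus)
  qed (auto simp: poly_ring_def polys_in_plus polys_in_0 algebra_simps)
  show "comm_monoid (poly_ring S)"
    by (rule comm_monoidI) (auto simp: poly_ring_def polys_in_times polys_in_1 algebra_simps)
qed (auto simp: poly_ring_def algebra_simps)

end

theory Submission
  imports Defs "HOL-Computational_Algebra.Polynomial"
begin

text \<open>
  Write \<open>K[S]\<close> for the ring of polynomials in the variables indexed by \<open>S\<close>, and let \<open>Q\<close> be the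
  contraction of \<open>P\<close> to \<open>K[C]\<close>. It is a prime ideal, nonzero because \<open>C\<close> is
  dependent, and for any \<open>e \<in> C\<close> it meets \<open>K[C - {e}]\<close> only in 0 because \<open>C\<close> is minimally
  dependent. (A circuit is nonempty: a dependent empty set would put a nonzero constant into \<open>P\<close>.)
  Fix such an \<open>e\<close>, put \<open>S = C - {e}\<close>, and let \<open>f\<close> be a nonzero element of \<open>Q\<close> for which the sum of
  the degrees in the single variables is least. Since \<open>Q\<close> is prime, one factor of any factorization
  of \<open>f\<close> lies in \<open>Q\<close>, and by minimality the other is constant; so \<open>f\<close> is irreducible, and it involves
  \<open>X\<^sub>e\<close>. If some \<open>g \<in> Q\<close> were not a multiple of \<open>f\<close>, then \<open>f\<close> and \<open>g\<close> would be coprime as polynomials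
  in \<open>X\<^sub>e\<close> over the field of fractions of \<open>K[S]\<close>, and clearing denominators in a Bezout relation would
  give a nonzero element of \<open>Q \<inter> K[S]\<close>, a contradiction. Hence \<open>f\<close> generates \<open>Q\<close>. Two generators divide
  each other, and units are constants because degrees add up in products.

  The Bezout relation is \<open>Bezout_eliminates_variable\<close>. It is proved without fractions: a nonzero element \<open>d\<close>
  of least degree in \<open>X\<^sub>e\<close> in the ideal generated by \<open>f\<close> and \<open>g\<close> divides both up to a factor from \<open>K[S]\<close>, by
  \<open>pseudo_division\<close>, and Gauss's lemma, in the form \<open>Gauss_cancel\<close>, removes that factor. Gauss's lemma
  over \<open>K[S]\<close> needs irreducible elements of \<open>K[S]\<close> to be prime there. This is
  \<open>irreducible_imp_prime_on\<close>, proved by induction on the finite set \<open>S\<close>; its induction step is again the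
  Bezout relation, now over the smaller set.

  Polynomials in all sets of variables live in one type, so divisibility, units and irreducibility are
  those of the whole ring. Nothing is lost: by \<open>factor_in_polys_in\<close> the factors of a nonzero element of
  \<open>K[S]\<close> lie in \<open>K[S]\<close>. To speak of the degree and the coefficients in one variable, a polynomial is
  turned into a univariate polynomial by \<open>as_poly\<close>, of which evaluation at \<open>X\<^sub>e\<close> is the inverse.
\<close>

section \<open>Subrings of polynomials in a set of variables\<close>

lemma polys_in_mono: "S \<subseteq> T \<Longrightarrow> polys_in S \<subseteq> polys_in T"
  unfolding polys_in_def by blast

lemma polys_in_diff: "p \<in> polys_in S \<Longrightarrow> q \<in> polys_in S \<Longrightarrow> p - q \<in> polys_in S"
  using polys_in_plus[of p S "- q"] polys_in_uminus[of q S] by simp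

lemma polys_in_sum: "(\<And>i. i \<in> I \<Longrightarrow> f i \<in> polys_in S) \<Longrightarrow> sum f I \<in> polys_in S"
  by (induction I rule: infinite_finite_induct) (auto intro: polys_in_plus polys_in_0)

lemma polys_in_single: "Poly_Mapping.keys m \<subseteq> S \<Longrightarrow> Poly_Mapping.single m c \<in> polys_in S"
  unfolding polys_in_def by simp

lemma polys_in_power: "p \<in> polys_in S \<Longrightarrow> p ^ n \<in> polys_in S"
  by (induction n) (auto intro: polys_in_times polys_in_1)

lemma polys_in_finite:
  fixes p :: "('e, 'k::field) mpoly"
  obtains S where "finite S" "p \<in> polys_in S"
proof
  show "finite (\<Union>m\<in>Poly_Mapping.keys p. Poly_Mapping.keys m)" by simp
qed (auto simp: polys_in_def)

lemma polys_in_eq_Inter: "polys_in S = (\<Inter>e\<in>-S. polys_in (-{e}))"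
  unfolding polys_in_def by blast

lemma polys_in_empty: "p \<in> polys_in {} \<longleftrightarrow> (\<exists>c. p = const c)"
proof
  assume "p \<in> polys_in {}"
  then have "Poly_Mapping.keys p \<subseteq> {0}"
    unfolding polys_in_def by (auto simp: poly_mapping_eq_iff fun_eq_iff in_keys_iff)
  then have "p = const (Poly_Mapping.lookup p 0)"
    unfolding const_def
    by (intro poly_mapping_eqI) (auto simp: lookup_single when_def in_keys_iff)
  then show "\<exists>c. p = const c" ..
qed (auto simp: const_def intro!: polys_in_single)

lemma const_mult: "const a * const b = const (a * b)"
  by (simp add: const_def mult_single)

lemma const_eq_0_iff: "const a = 0 \<longleftrightarrow> a = 0"
  by (metis const_def lookup_single_eq lookup_zero single_zero)

lemma const_1: "const 1 = 1"
  by (simp add: const_def)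

section \<open>Polynomials as univariate polynomials in one variable\<close>

definition X :: "'e \<Rightarrow> ('e, 'k::field) mpoly" where
  "X e = Poly_Mapping.single (Poly_Mapping.single e 1) 1"

lemma X_power: "X e ^ i = Poly_Mapping.single (Poly_Mapping.single e i) 1"
  by (induction i) (auto simp: X_def mult_single simp flip: single_add)

lemma X_in_polys_in: "e \<in> S \<Longrightarrow> X e \<in> polys_in S"
  unfolding X_def by (rule polys_in_single) simp

lemma sum_monomials: "p = (\<Sum>m\<in>Poly_Mapping.keys p. Poly_Mapping.single m (Poly_Mapping.lookup p m))"
proof (rule poly_mapping_eqI)
  fix k
  show "Poly_Mapping.lookup p k = Poly_Mapping.lookup
      (\<Sum>m\<in>Poly_Mapping.keys p. Poly_Mapping.single m (Poly_Mapping.lookup p m)) k"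
    by (auto simp: lookup_sum lookup_single when_def in_keys_iff)
qed

text \<open>Each monomial is split into its power of \<open>X e\<close> and the rest; the rest goes into the coefficient.\<close>

definition as_poly :: "'e \<Rightarrow> ('e, 'k::field) mpoly \<Rightarrow> ('e, 'k) mpoly poly" where
  "as_poly e p = (\<Sum>m\<in>Poly_Mapping.keys p.
     monom (Poly_Mapping.single (m - Poly_Mapping.single e (Poly_Mapping.lookup m e))
       (Poly_Mapping.lookup p m)) (Poly_Mapping.lookup m e))"

lemma minus_exponent_plus:
  fixes m :: "'e \<Rightarrow>\<^sub>0 nat"
  assumes "i \<le> Poly_Mapping.lookup m e"
  shows "m - Poly_Mapping.single e i + Poly_Mapping.single e i = m"
  using assms by (intro poly_mapping_eqI) (auto simp: lookup_add lookup_minus lookup_single when_def)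

lemma poly_as_poly: "poly (as_poly e p) (X e) = p"
proof -
  have "poly (as_poly e p) (X e) =
      (\<Sum>m\<in>Poly_Mapping.keys p. Poly_Mapping.single m (Poly_Mapping.lookup p m))"
    unfolding as_poly_def poly_sum
    by (rule sum.cong) (simp_all add: poly_monom X_power mult_single minus_exponent_plus)
  then show ?thesis
    using sum_monomials[of p] by simp
qed

lemma coeff_as_poly_in: "p \<in> polys_in S \<Longrightarrow> coeff (as_poly e p) i \<in> polys_in (S - {e})"
  unfolding as_poly_def coeff_sum
proof (rule polys_in_sum)
  fix m assume p: "p \<in> polys_in S" and m: "m \<in> Poly_Mapping.keys p"
  have "Poly_Mapping.keys (m - Poly_Mapping.single e (Poly_Mapping.lookup m e)) \<subseteq> S - {e}"
    using p m unfolding polys_in_def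
    by (fastforce simp: in_keys_iff lookup_minus lookup_single when_def split: if_splits)
  then show "coeff (monom (Poly_Mapping.single (m - Poly_Mapping.single e (Poly_Mapping.lookup m e))
       (Poly_Mapping.lookup p m)) (Poly_Mapping.lookup m e)) i \<in> polys_in (S - {e})"
    by (auto intro: polys_in_single polys_in_0)
qed

lemma coeff_as_poly_avoids: "coeff (as_poly e p) i \<in> polys_in (-{e})"
  using coeff_as_poly_in[of p UNIV e i] by (simp add: polys_in_def Compl_eq_Diff_UNIV)

lemma coeff_as_poly_insert:
  "p \<in> polys_in (insert e S) \<Longrightarrow> e \<notin> S \<Longrightarrow> coeff (as_poly e p) i \<in> polys_in S"
  using coeff_as_poly_in[of p "insert e S" e i] by simp

text \<open>If \<open>c\<close> does not involve \<open>X e\<close>, the exponent of \<open>X e\<close> in a monomial of \<open>c * X e ^ j\<close> is \<open>j\<close>, so the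
  summands of an expansion in powers of \<open>X e\<close> do not interfere with each other.\<close>

lemma lookup_mult_X_power:
  fixes c :: "('e, 'k::field) mpoly"
  assumes c: "c \<in> polys_in (-{e})" and m: "e \<notin> Poly_Mapping.keys m"
  shows "Poly_Mapping.lookup (c * X e ^ j) (m + Poly_Mapping.single e i) =
    (if i = j then Poly_Mapping.lookup c m else 0)"
proof -
  have eq: "k + Poly_Mapping.single e j = m + Poly_Mapping.single e i \<longleftrightarrow> k = m \<and> i = j"
    if "k \<in> Poly_Mapping.keys c" for k
  proof
    assume *: "k + Poly_Mapping.single e j = m + Poly_Mapping.single e i"
    have "Poly_Mapping.lookup k e = 0" "Poly_Mapping.lookup m e = 0"
      using c that m by (auto simp: polys_in_def in_keys_iff)
    then have "i = j"
      using arg_cong[OF *, of "\<lambda>x. Poly_Mapping.lookup x e"] by (simp add: lookup_add)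
    with * show "k = m \<and> i = j" by simp
  qed simp
  have "c * X e ^ j = (\<Sum>k\<in>Poly_Mapping.keys c.
      Poly_Mapping.single (k + Poly_Mapping.single e j) (Poly_Mapping.lookup c k))"
    by (subst sum_monomials[of c]) (simp add: sum_distrib_right X_power mult_single)
  then have "Poly_Mapping.lookup (c * X e ^ j) (m + Poly_Mapping.single e i) =
      (\<Sum>k\<in>Poly_Mapping.keys c. if k = m \<and> i = j then Poly_Mapping.lookup c k else 0)"
    by (auto simp: lookup_sum lookup_single when_def eq intro!: sum.cong)
  also have "\<dots> = (if i = j then Poly_Mapping.lookup c m else 0)"
    by (auto simp: in_keys_iff)
  finally show ?thesis .
qed

lemma poly_X_eq_0:
  fixes F :: "('e, 'k::field) mpoly poly"
  assumes F: "\<And>i. coeff F i \<in> polys_in (-{e})" and 0: "poly F (X e) = 0"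
  shows "F = 0"
proof (rule poly_eqI)
  fix i
  have "Poly_Mapping.lookup (coeff F i) m = 0" for m
  proof (cases "e \<in> Poly_Mapping.keys m")
    case True
    then have "m \<notin> Poly_Mapping.keys (coeff F i)"
      using F[of i] unfolding polys_in_def by blast
    then show ?thesis by (simp add: in_keys_iff)
  next
    case False
    have "0 = Poly_Mapping.lookup (poly F (X e)) (m + Poly_Mapping.single e i)"
      using 0 by simp
    also have "\<dots> = (\<Sum>j\<le>degree F. if i = j then Poly_Mapping.lookup (coeff F j) m else 0)"
      by (simp add: poly_altdef lookup_sum lookup_mult_X_power[OF F False])
    also have "\<dots> = Poly_Mapping.lookup (coeff F i) m"
      by (auto simp: coeff_eq_0)
    finally show ?thesis by simp
  qed
  then show "coeff F i = coeff 0 i"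
    by (auto intro: poly_mapping_eqI)
qed

text \<open>The expansion in powers of \<open>X e\<close> is unique. Since evaluation at \<open>X e\<close> is a ring homomorphism,
  \<open>as_poly e\<close> is therefore one as well.\<close>

lemma as_poly_eqI:
  assumes "\<And>i. coeff F i \<in> polys_in (-{e})" "poly F (X e) = p"
  shows "as_poly e p = F"
proof -
  have "as_poly e p - F = 0"
    by (rule poly_X_eq_0[of _ e])
      (auto simp: poly_as_poly assms intro: polys_in_diff coeff_as_poly_avoids)
  then show ?thesis by simp
qed

lemma as_poly_diff: "as_poly e (p - q) = as_poly e p - as_poly e q"
  by (rule as_poly_eqI) (auto simp: poly_as_poly intro: polys_in_diff coeff_as_poly_avoids)

lemma as_poly_mult: "as_poly e (p * q) = as_poly e p * as_poly e q"
  by (rule as_poly_eqI)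
    (auto simp: poly_as_poly coeff_mult intro!: polys_in_sum polys_in_times coeff_as_poly_avoids)

lemma as_poly_const: "p \<in> polys_in (-{e}) \<Longrightarrow> as_poly e p = [:p:]"
  by (rule as_poly_eqI) (auto simp: coeff_pCons polys_in_0 split: nat.splits)

lemma as_poly_X_power: "as_poly e (X e ^ n) = monom 1 n"
  by (rule as_poly_eqI) (auto simp: poly_monom polys_in_0 polys_in_1)

lemma as_poly_eq_0_iff: "as_poly e p = 0 \<longleftrightarrow> p = 0"
  using as_poly_const[of 0 e] poly_as_poly[of e p] by (auto simp: polys_in_0)

lemma degree_as_poly_0_iff: "degree (as_poly e p) = 0 \<longleftrightarrow> p \<in> polys_in (-{e})"
proof
  assume "degree (as_poly e p) = 0"
  then obtain c where c: "as_poly e p = [:c:]" by (rule degree_eq_zeroE)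
  then have "p = c" using poly_as_poly[of e p] by simp
  then show "p \<in> polys_in (-{e})" using coeff_as_poly_avoids[of e p 0] c by simp
qed (simp add: as_poly_const)

section \<open>Degrees, units and irreducible factors\<close>

text \<open>The type \<open>'e\<close> carries no order, so there is no leading monomial to look at. Instead the variables
  that occur are removed one at a time, by passing to the leading coefficients in one of them.\<close>

lemma mpoly_mult_eq_0:
  fixes p q :: "('e, 'k::field) mpoly"
  assumes "p * q = 0"
  shows "p = 0 \<or> q = 0"
proof -
  have main: "p = 0 \<or> q = 0"
    if "finite S" "p \<in> polys_in S" "q \<in> polys_in S" "p * q = 0" for S and p q :: "('e, 'k) mpoly"
    using that
  proof (induction S arbitrary: p q rule: finite_induct)
    case empty
    then show ?case by (auto simp: polys_in_empty const_mult const_eq_0_iff)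
  next
    case (insert e S)
    have "as_poly e p * as_poly e q = 0"
      using insert.prems(3) as_poly_eq_0_iff as_poly_mult by metis
    then have "lead_coeff (as_poly e p) * lead_coeff (as_poly e q) = 0"
      using coeff_mult_degree_sum[of "as_poly e p" "as_poly e q"] by simp
    then have "lead_coeff (as_poly e p) = 0 \<or> lead_coeff (as_poly e q) = 0"
      using insert by (intro insert.IH coeff_as_poly_insert) auto
    then show ?case by (simp add: as_poly_eq_0_iff)
  qed
  obtain S T where "finite S" "p \<in> polys_in S" "finite T" "q \<in> polys_in T"
    using polys_in_finite by metis
  then show ?thesis
    using assms main[of "S \<union> T"] polys_in_mono[of S "S \<union> T"] polys_in_mono[of T "S \<union> T"] by blast
qed

lemma mpoly_mult_left_cancel:
  fixes a b c :: "('e, 'k::field) mpoly"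
  assumes "a \<noteq> 0" "a * b = a * c"
  shows "b = c"
  using mpoly_mult_eq_0[of a "b - c"] assms by (simp add: algebra_simps)

lemma degree_as_poly_mult:
  fixes p q :: "('e, 'k::field) mpoly"
  assumes "p \<noteq> 0" "q \<noteq> 0"
  shows "degree (as_poly e (p * q)) = degree (as_poly e p) + degree (as_poly e q)"
proof (rule antisym)
  have "lead_coeff (as_poly e p) * lead_coeff (as_poly e q) \<noteq> 0"
    using mpoly_mult_eq_0 assms as_poly_eq_0_iff leading_coeff_0_iff by metis
  then show "degree (as_poly e p) + degree (as_poly e q) \<le> degree (as_poly e (p * q))"
    unfolding as_poly_mult by (intro le_degree) (simp add: coeff_mult_degree_sum)
qed (simp add: as_poly_mult degree_mult_le)

text \<open>Avoiding \<open>X e\<close> means having degree 0 in it, and degrees are additive.\<close>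

lemma factor_in_polys_in:
  fixes p q :: "('e, 'k::field) mpoly"
  assumes "p * q \<in> polys_in S" "p * q \<noteq> 0"
  shows "p \<in> polys_in S"
  unfolding polys_in_eq_Inter[of S]
proof
  fix e assume "e \<in> - S"
  then have "p * q \<in> polys_in (-{e})" using assms polys_in_eq_Inter by blast
  moreover have "p \<noteq> 0" "q \<noteq> 0" using assms by auto
  ultimately show "p \<in> polys_in (-{e})"
    using degree_as_poly_mult[of p q e] by (simp flip: degree_as_poly_0_iff)
qed

lemma mpoly_unit_iff:
  fixes p :: "('e, 'k::field) mpoly"
  shows "p dvd 1 \<longleftrightarrow> (\<exists>u. u \<noteq> 0 \<and> p = const u)"
proof
  assume "p dvd 1"
  then obtain q where q: "p * q = 1" by (metis dvdE)
  then have "p \<in> polys_in {}"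
    using factor_in_polys_in[of p q "{}"] by (simp add: polys_in_1)
  then show "\<exists>u. u \<noteq> 0 \<and> p = const u"
    using q by (metis polys_in_empty const_eq_0_iff mult_zero_left zero_neq_one)
next
  assume "\<exists>u. u \<noteq> 0 \<and> p = const u"
  then obtain u where "u \<noteq> 0" "p = const u" by blast
  then have "p * const (inverse u) = 1" by (simp add: const_mult const_1)
  then show "p dvd 1" by (metis dvd_triv_left)
qed

lemma unit_in_polys_in: "(p :: ('e, 'k::field) mpoly) dvd 1 \<Longrightarrow> p \<in> polys_in S"
  by (auto simp: mpoly_unit_iff const_def intro: polys_in_single)

text \<open>This plays the role of the total degree; it is visibly additive on products.\<close>

definition degree_sum :: "'e set \<Rightarrow> ('e, 'k::field) mpoly \<Rightarrow> nat" where
  "degree_sum S p = (\<Sum>e\<in>S. degree (as_poly e p))"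

lemma degree_sum_mult:
  "p \<noteq> 0 \<Longrightarrow> q \<noteq> 0 \<Longrightarrow> degree_sum S (p * q) = degree_sum S p + degree_sum S q"
  by (simp add: degree_sum_def degree_as_poly_mult sum.distrib)

lemma degree_sum_0_imp_unit:
  assumes "finite S" "p \<in> polys_in S" "p \<noteq> 0" "degree_sum S p = 0"
  shows "p dvd 1"
proof -
  have "p \<in> polys_in (-{e})" for e
  proof (cases "e \<in> S")
    case True
    then show ?thesis using assms by (simp add: degree_sum_def degree_as_poly_0_iff)
  next
    case False
    then show ?thesis using assms polys_in_eq_Inter by blast
  qed
  then have "p \<in> polys_in {}" by (subst polys_in_eq_Inter) auto
  then show ?thesis using assms by (auto simp: mpoly_unit_iff polys_in_empty const_eq_0_iff)
qed

lemma exists_irreducible_factor: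
  fixes a :: "('e, 'k::field) mpoly"
  assumes "finite S" "a \<in> polys_in S" "a \<noteq> 0" "\<not> a dvd 1"
  shows "\<exists>p. irreducible p \<and> p dvd a"
  using assms(2-)
proof (induction "degree_sum S a" arbitrary: a rule: less_induct)
  case less
  show ?case
  proof (cases "irreducible a")
    case False
    then obtain u v where uv: "a = u * v" "\<not> u dvd 1" "\<not> v dvd 1"
      using less.prems by (auto simp: irreducible_def)
    then have nz: "u \<noteq> 0" "v \<noteq> 0" using less.prems by auto
    have "u \<in> polys_in S" "v \<in> polys_in S"
      using factor_in_polys_in[of u v S] factor_in_polys_in[of v u S] uv less.prems
      by (auto simp: mult.commute)
    moreover have "degree_sum S v > 0"
      using degree_sum_0_imp_unit[OF assms(1) \<open>v \<in> polys_in S\<close>] nz uv by blast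
    ultimately obtain p where "irreducible p" "p dvd u"
      using less.hyps[of u] uv nz by (auto simp: degree_sum_mult)
    then show ?thesis using uv by auto
  qed auto
qed

section \<open>Gauss's lemma\<close>

text \<open>The usual condition on prime elements, tested in the subring \<open>K[S]\<close> only. Zero and units satisfy
  it as well; it is used for irreducible elements.\<close>

definition prime_on :: "'e set \<Rightarrow> ('e, 'k::field) mpoly \<Rightarrow> bool" where
  "prime_on S p \<longleftrightarrow> (\<forall>g\<in>polys_in S. \<forall>h\<in>polys_in S. p dvd g * h \<longrightarrow> p dvd g \<or> p dvd h)"

lemma dvd_iff_dvd_coeffs:
  fixes p f :: "('e, 'k::field) mpoly"
  assumes "p \<in> polys_in (-{e})"
  shows "p dvd f \<longleftrightarrow> (\<forall>i. p dvd coeff (as_poly e f) i)"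
proof
  assume "p dvd f"
  then obtain k where "f = p * k" by (rule dvdE)
  then show "\<forall>i. p dvd coeff (as_poly e f) i"
    using assms by (simp add: as_poly_mult as_poly_const)
next
  assume "\<forall>i. p dvd coeff (as_poly e f) i"
  then have "p dvd poly (as_poly e f) (X e)"
    unfolding poly_altdef by (intro dvd_sum) auto
  then show "p dvd f" by (simp add: poly_as_poly)
qed

text \<open>If \<open>p\<close> divides neither \<open>g\<close> nor \<open>h\<close>, consider the lowest coefficients of \<open>g\<close> and \<open>h\<close> with respect to
  \<open>X e\<close> that are not divisible by \<open>p\<close>, of index \<open>i\<close> and \<open>j\<close>. In the coefficient of index \<open>i + j\<close> of \<open>g * h\<close>
  the product of these two is the only summand not visibly divisible by \<open>p\<close>.\<close>

lemma prime_on_insert: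
  fixes p :: "('e, 'k::field) mpoly"
  assumes p: "p \<in> polys_in S" "prime_on S p" and e: "e \<notin> S"
  shows "prime_on (insert e S) p"
  unfolding prime_on_def
proof (intro ballI impI)
  fix g h :: "('e, 'k) mpoly"
  assume g: "g \<in> polys_in (insert e S)" and h: "h \<in> polys_in (insert e S)" and dvd: "p dvd g * h"
  let ?G = "as_poly e g" and ?H = "as_poly e h"
  have p': "p \<in> polys_in (-{e})" using p e polys_in_mono[of S "-{e}"] by blast
  show "p dvd g \<or> p dvd h"
  proof (rule ccontr)
    assume *: "\<not> (p dvd g \<or> p dvd h)"
    define i where "i = (LEAST i. \<not> p dvd coeff ?G i)"
    define j where "j = (LEAST j. \<not> p dvd coeff ?H j)"
    have i: "\<not> p dvd coeff ?G i" and il: "\<And>k. k < i \<Longrightarrow> p dvd coeff ?G k"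
      using * dvd_iff_dvd_coeffs[OF p', of g] unfolding i_def
      by (metis (mono_tags, lifting) LeastI, metis not_less_Least)
    have j: "\<not> p dvd coeff ?H j" and jl: "\<And>k. k < j \<Longrightarrow> p dvd coeff ?H k"
      using * dvd_iff_dvd_coeffs[OF p', of h] unfolding j_def
      by (metis (mono_tags, lifting) LeastI, metis not_less_Least)
    have "coeff (?G * ?H) (i + j) = (\<Sum>k\<le>i+j. coeff ?G k * coeff ?H (i + j - k))"
      by (rule coeff_mult)
    also have "\<dots> = coeff ?G i * coeff ?H j +
        (\<Sum>k\<in>{..i+j} - {i}. coeff ?G k * coeff ?H (i + j - k))"
      by (subst sum.remove[of _ i]) auto
    finally have eq: "coeff ?G i * coeff ?H j = coeff (?G * ?H) (i + j) -
        (\<Sum>k\<in>{..i+j} - {i}. coeff ?G k * coeff ?H (i + j - k))" by simp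
    have "p dvd coeff ?G i * coeff ?H j"
      unfolding eq
    proof (intro dvd_diff dvd_sum)
      show "p dvd coeff (?G * ?H) (i + j)"
        using dvd dvd_iff_dvd_coeffs[OF p', of "g * h"] by (simp add: as_poly_mult)
      fix k assume "k \<in> {..i+j} - {i}"
      then have "k < i \<or> i + j - k < j" by auto
      then show "p dvd coeff ?G k * coeff ?H (i + j - k)"
        using il jl by auto
    qed
    then show False
      using p(2) i j coeff_as_poly_insert[OF g e] coeff_as_poly_insert[OF h e]
      unfolding prime_on_def by blast
  qed
qed

text \<open>Gauss's lemma: a factor \<open>a \<in> K[S]\<close> can be cancelled from \<open>a * f = q * d\<close> at the cost of changing
  \<open>q\<close> and \<open>d\<close> by factors from \<open>K[S]\<close>. Each irreducible factor of \<open>a\<close> is prime also after \<open>X e\<close> is adjoined,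
  hence divides \<open>q\<close> or \<open>d\<close> and can be cancelled there; \<open>c\<close> collects the factors taken from \<open>d\<close>.

  That irreducible elements of \<open>K[S]\<close> are prime is a hypothesis here and in the next lemmas,
  because they serve in the induction that proves it.\<close>

lemma Gauss_cancel:
  fixes a f q d :: "('e, 'k::field) mpoly"
  assumes S: "finite S" "e \<notin> S"
    and prime: "\<And>p :: ('e, 'k) mpoly. p \<in> polys_in S \<Longrightarrow> irreducible p \<Longrightarrow> prime_on S p"
    and "a \<in> polys_in S" "a \<noteq> 0" "q \<in> polys_in (insert e S)" "d \<in> polys_in (insert e S)"
    and "f \<noteq> 0" "a * f = q * d"
  obtains q' d' c where "f = q' * d'" "d = c * d'" "c \<in> polys_in S"
proof -
  have "\<exists>q' d' c. f = q' * d' \<and> d = c * d' \<and> c \<in> polys_in S"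
    using assms(4-7,9)
  proof (induction "degree_sum S a" arbitrary: a q d rule: less_induct)
    case less
    show ?case
    proof (cases "a dvd 1")
      case True
      then obtain b where "1 = a * b" by (rule dvdE)
      then have "f = (b * q) * d" using less.prems by (metis mult.assoc mult.commute mult_1)
      then show ?thesis by (metis mult_1 polys_in_1)
    next
      case False
      then obtain p where p: "irreducible p" "p dvd a"
        using exists_irreducible_factor S(1) less.prems by blast
      then obtain a' where a': "a = p * a'" by (auto elim: dvdE)
      have nz: "p \<noteq> 0" "a' \<noteq> 0" using a' less.prems by auto
      have in_S: "p \<in> polys_in S" "a' \<in> polys_in S"
        using factor_in_polys_in[of p a' S] factor_in_polys_in[of a' p S] a' less.prems
        by (auto simp: mult.commute)
      have "degree_sum S p > 0"
        using degree_sum_0_imp_unit[OF S(1) in_S(1)] nz p by (auto simp: irreducible_def)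
      then have smaller: "degree_sum S a' < degree_sum S a"
        using nz by (simp add: a' degree_sum_mult)
      have "p dvd q * d" using less.prems(5) a' by (metis dvd_triv_left mult.assoc)
      then have "p dvd q \<or> p dvd d"
        using prime_on_insert[OF in_S(1) prime[OF in_S(1) p(1)] S(2)] less.prems
        unfolding prime_on_def by blast
      moreover have product: "q * d \<noteq> 0"
        using mpoly_mult_eq_0[of a f] less.prems \<open>f \<noteq> 0\<close> by auto
      ultimately show ?thesis
      proof (elim disjE)
        assume "p dvd q"
        then obtain k where k: "q = p * k" by (rule dvdE)
        have "p * (a' * f) = p * (k * d)"
          using less.prems(5) unfolding a' k by (simp only: ac_simps)
        then have "a' * f = k * d" by (rule mpoly_mult_left_cancel[OF nz(1)])
        moreover have "q \<noteq> 0" using product by auto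
        then have "k \<in> polys_in (insert e S)"
          using factor_in_polys_in[of k p] k less.prems by (simp add: mult.commute)
        ultimately show ?thesis
          using less.hyps[OF smaller in_S(2) nz(2)] less.prems by blast
      next
        assume "p dvd d"
        then obtain k where k: "d = p * k" by (rule dvdE)
        have "p * (a' * f) = p * (q * k)"
          using less.prems(5) unfolding a' k by (simp only: ac_simps)
        then have "a' * f = q * k" by (rule mpoly_mult_left_cancel[OF nz(1)])
        moreover have "d \<noteq> 0" using product by auto
        then have "k \<in> polys_in (insert e S)"
          using factor_in_polys_in[of k p] k less.prems by (simp add: mult.commute)
        ultimately obtain q' d' c where "f = q' * d'" "k = c * d'" "c \<in> polys_in S"
          using less.hyps[OF smaller in_S(2) nz(2)] less.prems by blast
        then have "f = q' * d'" "d = (p * c) * d'" "p * c \<in> polys_in S"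
          using k in_S by (auto simp: mult.assoc intro: polys_in_times)
        then show ?thesis by blast
      qed
    qed
  qed
  then show thesis using that by blast
qed

text \<open>Writing \<open>b * g = k * f\<close>, Gauss's lemma gives \<open>g = k' * f'\<close> with \<open>f = c * f'\<close> and \<open>c\<close> in \<open>K[S]\<close>. As
  \<open>f\<close> is irreducible and involves \<open>X e\<close>, the factor \<open>c\<close> is the unit, so \<open>f'\<close> is as good as \<open>f\<close>.\<close>

lemma Gauss_dvd:
  fixes b f g :: "('e, 'k::field) mpoly"
  assumes S: "finite S" "e \<notin> S"
    and prime: "\<And>p :: ('e, 'k) mpoly. p \<in> polys_in S \<Longrightarrow> irreducible p \<Longrightarrow> prime_on S p"
    and f: "f \<in> polys_in (insert e S)" "f \<notin> polys_in S" "irreducible f"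
    and g: "g \<in> polys_in (insert e S)" and b: "b \<in> polys_in S" "b \<noteq> 0" and dvd: "f dvd b * g"
  shows "f dvd g"
proof (cases "g = 0")
  case False
  from dvd obtain k where k: "b * g = k * f" by (metis dvdE mult.commute)
  have "b * g \<in> polys_in (insert e S)" "b * g \<noteq> 0"
    using b g False mpoly_mult_eq_0 polys_in_mono[of S "insert e S"] by (auto intro!: polys_in_times)
  then have "k \<in> polys_in (insert e S)" using factor_in_polys_in[of k f] k by simp
  then obtain k' f' c where c: "g = k' * f'" "f = c * f'" "c \<in> polys_in S"
    using Gauss_cancel[OF S prime b _ f(1) False k] by blast
  then have "c dvd 1 \<or> f' dvd 1" using f(3) by (auto simp: irreducible_def)
  moreover have "\<not> f' dvd 1"
    using c f(2) unit_in_polys_in[of f' S] by (auto intro: polys_in_times)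
  ultimately have "f dvd f'" using c by (metis mult_dvd_mono mult_1 dvd_refl)
  then show ?thesis using c by simp
qed simp

section \<open>Elimination of a variable\<close>

text \<open>Ordinary long division by \<open>d\<close> in the variable \<open>X e\<close>, except that the dividend is multiplied by the
  leading coefficient of \<open>d\<close> before each subtraction.\<close>

lemma pseudo_division:
  fixes d v :: "('e, 'k::field) mpoly"
  assumes e: "e \<notin> S" and d: "d \<in> polys_in (insert e S)" "d \<noteq> 0" and v: "v \<in> polys_in (insert e S)"
  obtains a q r where "a \<in> polys_in S" "a \<noteq> 0" "q \<in> polys_in (insert e S)" "a * v = q * d + r"
    "r = 0 \<or> degree (as_poly e r) < degree (as_poly e d)"
proof -
  define l m where "l = lead_coeff (as_poly e d)" and "m = degree (as_poly e d)"
  have l: "l \<in> polys_in S" "l \<noteq> 0"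
    unfolding l_def using coeff_as_poly_insert[OF d(1) e] d(2) by (auto simp: as_poly_eq_0_iff)
  have sub: "polys_in S \<subseteq> polys_in (insert e S)" "polys_in S \<subseteq> polys_in (-{e})"
    using e by (auto intro!: polys_in_mono)
  have "\<exists>a q r. a \<in> polys_in S \<and> a \<noteq> 0 \<and> q \<in> polys_in (insert e S) \<and> a * v = q * d + r \<and>
      (r = 0 \<or> degree (as_poly e r) < m)"
    \<comment> \<open>The bound is put on the vanishing coefficients and not on the degree, so that the case \<open>v = 0\<close>
      is not an exception.\<close>
    if "\<And>i. i \<ge> n \<Longrightarrow> coeff (as_poly e v) i = 0" "v \<in> polys_in (insert e S)" for n v
    using that
  proof (induction n arbitrary: v)
    case 0
    then have "as_poly e v = 0" by (intro poly_eqI) simp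
    then have "v = 0" by (simp add: as_poly_eq_0_iff)
    then show ?case
      by (intro exI[of _ 1] exI[of _ 0]) (auto simp: polys_in_0 polys_in_1)
  next
    case (Suc n)
    show ?case
    proof (cases "n < m")
      case True
      have "degree (as_poly e v) \<le> n"
        using Suc.prems(1) by (intro degree_le) auto
      then show ?thesis
        using True by (intro exI[of _ 1] exI[of _ 0] exI[of _ v]) (auto simp: polys_in_0 polys_in_1)
    next
      case False
      define c where "c = coeff (as_poly e v) n"
      have c: "c \<in> polys_in S" unfolding c_def using coeff_as_poly_insert[OF Suc.prems(2) e] .
      define t where "t = c * X e ^ (n - m)"
      have t: "t \<in> polys_in (insert e S)"
        unfolding t_def using c sub
        by (auto intro!: polys_in_times polys_in_power X_in_polys_in)
      define v' where "v' = l * v - t * d"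
      have v': "v' \<in> polys_in (insert e S)"
        unfolding v'_def using t l sub d Suc.prems by (auto intro!: polys_in_diff polys_in_times)
      have "as_poly e l = [:l:]" "as_poly e t = monom c (n - m)"
        unfolding t_def using l c sub
        by (auto simp: as_poly_const as_poly_mult as_poly_X_power smult_monom)
      then have v'_poly: "as_poly e v' = smult l (as_poly e v) - monom c (n - m) * as_poly e d"
        by (simp add: v'_def as_poly_diff as_poly_mult)
      have "coeff (as_poly e v') i = 0" if "i \<ge> n" for i
      proof (cases "i = n")
        case True
        then show ?thesis
          using False by (simp add: v'_poly coeff_monom_mult c_def l_def m_def[symmetric])
      next
        case False
        then have "coeff (as_poly e d) (i - (n - m)) = 0" if "n - m \<le> i"
          using \<open>\<not> n < m\<close> \<open>i \<ge> n\<close> that by (intro coeff_eq_0) (auto simp: m_def)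
        then show ?thesis
          using Suc.prems(1)[of i] False that by (simp add: v'_poly coeff_monom_mult)
      qed
      from Suc.IH[OF this v'] obtain a q r where IH: "a \<in> polys_in S" "a \<noteq> 0"
          "q \<in> polys_in (insert e S)" "a * v' = q * d + r" "r = 0 \<or> degree (as_poly e r) < m"
        by blast
      have "a * l \<noteq> 0" using IH l mpoly_mult_eq_0 by blast
      moreover have "a * l \<in> polys_in S" "q + a * t \<in> polys_in (insert e S)"
        using IH l t sub by (auto intro!: polys_in_times polys_in_plus)
      moreover have "a * l * v = (q + a * t) * d + r"
        using IH(4) by (simp add: v'_def algebra_simps)
      ultimately show ?thesis using IH(5) by blast
    qed
  qed
  from this[of "Suc (degree (as_poly e v))" v] v that show thesis
    unfolding m_def by (metis Suc_le_eq coeff_eq_0)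
qed

text \<open>A nonzero element \<open>d\<close> of least degree in \<open>X e\<close> in the ideal of \<open>f\<close> and \<open>g\<close> divides both of them up to
  factors from \<open>K[S]\<close>. By Gauss's lemma \<open>f = q' * d'\<close> where \<open>d\<close> is \<open>d'\<close> times an element of \<open>K[S]\<close>. If \<open>q'\<close>
  were a unit, \<open>f\<close> would divide a multiple \<open>b * g\<close> with \<open>b\<close> in \<open>K[S]\<close>, hence \<open>g\<close>. So \<open>d'\<close> is a unit, and
  \<open>d\<close> itself lies in \<open>K[S]\<close>.\<close>

lemma Bezout_eliminates_variable:
  fixes f g :: "('e, 'k::field) mpoly"
  assumes S: "finite S" "e \<notin> S"
    and prime: "\<And>p :: ('e, 'k) mpoly. p \<in> polys_in S \<Longrightarrow> irreducible p \<Longrightarrow> prime_on S p"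
    and f: "f \<in> polys_in (insert e S)" "f \<notin> polys_in S" "irreducible f"
    and g: "g \<in> polys_in (insert e S)" and ndvd: "\<not> f dvd g"
  obtains s t where "s \<in> polys_in (insert e S)" "t \<in> polys_in (insert e S)"
    "s * f + t * g \<in> polys_in S" "s * f + t * g \<noteq> 0"
proof -
  let ?R = "polys_in (insert e S) :: ('e, 'k) mpoly set"
  define I where "I = {s * f + t * g | s t. s \<in> ?R \<and> t \<in> ?R}"
  have I_R: "I \<subseteq> ?R" unfolding I_def using f g by (auto intro!: polys_in_plus polys_in_times)
  have I_comb: "a * u - q * v \<in> I" if "u \<in> I" "v \<in> I" "a \<in> ?R" "q \<in> ?R" for a u q v
  proof -
    from that obtain s t s' t' where st: "u = s * f + t * g" "v = s' * f + t' * g"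
      "s \<in> ?R" "t \<in> ?R" "s' \<in> ?R" "t' \<in> ?R" unfolding I_def by auto
    then have "a * u - q * v = (a * s - q * s') * f + (a * t - q * t') * g"
      by (simp add: algebra_simps)
    moreover have "a * s - q * s' \<in> ?R" "a * t - q * t' \<in> ?R"
      using st that by (auto intro!: polys_in_diff polys_in_times)
    ultimately show ?thesis unfolding I_def by blast
  qed
  have "f = 1 * f + 0 * g" "g = 0 * f + 1 * g" by simp_all
  then have fg: "f \<in> I" "g \<in> I"
    unfolding I_def using polys_in_0 polys_in_1 by blast+
  have "f \<noteq> 0" using f by auto
  obtain d where d: "d \<in> I" "d \<noteq> 0"
    and min: "\<And>r. r \<in> I \<Longrightarrow> r \<noteq> 0 \<Longrightarrow> degree (as_poly e d) \<le> degree (as_poly e r)"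
    using ex_has_least_nat[of "\<lambda>r. r \<in> I \<and> r \<noteq> 0" f "\<lambda>r. degree (as_poly e r)"] fg \<open>f \<noteq> 0\<close> by blast
  have dR: "d \<in> ?R" using d I_R by blast
  have S_R: "polys_in S \<subseteq> ?R" by (auto intro!: polys_in_mono)
  have multiple: "\<exists>a q. a \<in> polys_in S \<and> a \<noteq> 0 \<and> q \<in> ?R \<and> a * v = q * d" if v: "v \<in> I" for v
  proof -
    obtain a q r where *: "a \<in> polys_in S" "a \<noteq> 0" "q \<in> ?R" "a * v = q * d + r"
      "r = 0 \<or> degree (as_poly e r) < degree (as_poly e d)"
      using pseudo_division[OF S(2) dR d(2)] v I_R by blast
    have "r = a * v - q * d" using * by simp
    then have "r \<in> I" using I_comb[OF v d(1)] * S_R by blast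
    then have "r = 0" using min[of r] * by linarith
    then show ?thesis using * by auto
  qed
  obtain a q where a: "a \<in> polys_in S" "a \<noteq> 0" "q \<in> ?R" "a * f = q * d"
    using multiple fg by blast
  obtain b q2 where b: "b \<in> polys_in S" "b \<noteq> 0" "b * g = q2 * d"
    using multiple fg by blast
  obtain q' d' c where c: "f = q' * d'" "d = c * d'" "c \<in> polys_in S"
    using Gauss_cancel[OF S prime a(1-3) dR \<open>f \<noteq> 0\<close> a(4)] by blast
  have "\<not> q' dvd 1"
  proof
    assume "q' dvd 1"
    then have "f dvd d'" using c(1) by (metis mult_dvd_mono mult_1 dvd_refl)
    then have "f dvd b * g" using b c by simp
    then show False using Gauss_dvd[OF S prime f g b(1,2)] ndvd by blast
  qed
  then have "d' dvd 1" using c f by (auto simp: irreducible_def)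
  then have "d \<in> polys_in S" using c unit_in_polys_in by (auto intro: polys_in_times)
  then show thesis using that d unfolding I_def by blast
qed

text \<open>Suppose \<open>p\<close> divides \<open>g * h\<close> but not \<open>h\<close>. If \<open>p\<close> involves the new variable, it divides \<open>d * g\<close> for the
  nonzero \<open>d = s * p + t * h\<close> in \<open>K[S]\<close>, and Gauss's lemma discards \<open>d\<close>. If not, primality is inherited
  from \<open>K[S]\<close>.\<close>

lemma irreducible_imp_prime_on:
  fixes p :: "('e, 'k::field) mpoly"
  assumes "finite S" "p \<in> polys_in S" "irreducible p"
  shows "prime_on S p"
  using assms
proof (induction S arbitrary: p rule: finite_induct)
  case empty
  then have "p dvd 1"
    by (metis irreducible_def polys_in_empty const_eq_0_iff mpoly_unit_iff)
  then show ?case using empty by (simp add: irreducible_def)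
next
  case (insert e S)
  show ?case
  proof (cases "p \<in> polys_in S")
    case True
    show ?thesis
      by (rule prime_on_insert[OF True insert.IH[OF True insert.prems(2)] insert.hyps(2)])
  next
    case False
    show ?thesis
      unfolding prime_on_def
    proof (intro ballI impI)
      fix g h :: "('e, 'k) mpoly"
      assume g: "g \<in> polys_in (insert e S)" and h: "h \<in> polys_in (insert e S)" and dvd: "p dvd g * h"
      show "p dvd g \<or> p dvd h"
      proof (rule disjCI)
        assume "\<not> p dvd h"
        then obtain s t where st: "s * p + t * h \<in> polys_in S" "s * p + t * h \<noteq> 0"
          using Bezout_eliminates_variable[OF insert.hyps insert.IH insert.prems(1) False insert.prems(2) h]
          by blast
        have "(s * p + t * h) * g = (s * g) * p + t * (g * h)" by (simp add: algebra_simps)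
        then have "p dvd (s * p + t * h) * g" using dvd by simp
        then show "p dvd g"
          using Gauss_dvd[OF insert.hyps insert.IH insert.prems(1) False insert.prems(2) g st] by blast
      qed
    qed
  qed
qed

section \<open>Principal contractions of prime ideals\<close>

lemma prime_ideal_with_trivial_elimination_is_principal:
  fixes Q :: "('e, 'k::field) mpoly set"
  assumes C: "finite C" "e \<in> C"
    and QC: "Q \<subseteq> polys_in C" and Q0: "Q \<noteq> {0}"
    and ideal: "\<And>a b q r. a \<in> polys_in C \<Longrightarrow> b \<in> polys_in C \<Longrightarrow> q \<in> Q \<Longrightarrow> r \<in> Q \<Longrightarrow> a * q + b * r \<in> Q"
    and prime: "\<And>a b. a \<in> polys_in C \<Longrightarrow> b \<in> polys_in C \<Longrightarrow> a * b \<in> Q \<Longrightarrow> a \<in> Q \<or> b \<in> Q"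
    and elimination: "Q \<inter> polys_in (C - {e}) = {0}"
  obtains f where "f \<in> Q" "f \<noteq> 0" "\<And>g. g \<in> Q \<Longrightarrow> f dvd g"
proof -
  obtain f0 where "f0 \<in> Q" "f0 \<noteq> 0" using Q0 elimination by blast
  then obtain f where f: "f \<in> Q" "f \<noteq> 0"
    and min: "\<And>r. r \<in> Q \<Longrightarrow> r \<noteq> 0 \<Longrightarrow> degree_sum C f \<le> degree_sum C r"
    using ex_has_least_nat[of "\<lambda>r. r \<in> Q \<and> r \<noteq> 0" f0 "degree_sum C"] by blast
  have fC: "f \<in> polys_in C" using f QC by blast
  have f_notin: "f \<notin> polys_in (C - {e})" using f elimination by blast
  \<comment> \<open>If \<open>v\<close> had positive degree, \<open>u\<close> would be an element of \<open>Q\<close> of smaller degree than \<open>f\<close>.\<close>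
  have unit: "v dvd 1" if "f = u * v" "u \<in> Q" for u v
  proof -
    have nz: "u \<noteq> 0" "v \<noteq> 0" using that f by auto
    then have "degree_sum C v = 0" using min[of u] that by (simp add: degree_sum_mult)
    moreover have "v \<in> polys_in C"
      using factor_in_polys_in[of v u C] that fC f(2) by (simp add: mult.commute)
    ultimately show ?thesis using degree_sum_0_imp_unit C nz by blast
  qed
  have irr: "irreducible f"
    unfolding irreducible_def
  proof (intro conjI allI impI)
    show "f \<noteq> 0" by fact
    show "\<not> f dvd 1" using f_notin unit_in_polys_in by blast
    fix u v assume uv: "f = u * v"
    have "u \<in> polys_in C" "v \<in> polys_in C"
      using factor_in_polys_in[of u v C] factor_in_polys_in[of v u C] uv fC f(2)
      by (auto simp: mult.commute)
    then have "u \<in> Q \<or> v \<in> Q" using prime f uv by blast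
    then show "u dvd 1 \<or> v dvd 1" using unit[of u v] unit[of v u] uv by (auto simp: mult.commute)
  qed
  have ins: "insert e (C - {e}) = C" using C by auto
  have "f dvd g" if g: "g \<in> Q" for g
  proof (rule ccontr)
    assume "\<not> f dvd g"
    then obtain s t where st: "s \<in> polys_in C" "t \<in> polys_in C"
      "s * f + t * g \<in> polys_in (C - {e})" "s * f + t * g \<noteq> 0"
      using Bezout_eliminates_variable[of "C - {e}" e f g, unfolded ins] C fC f_notin irr g QC
        irreducible_imp_prime_on[of "C - {e}"] by blast
    then have "s * f + t * g \<in> Q" using ideal f g by blast
    then show False using st elimination by blast
  qed
  then show thesis using that f by blast
qed

theorem lemma5p6:
  fixes E C :: "'e set"
    and P :: "('e, 'k::field) mpoly set"
    and M :: "'e set \<times> 'e set set"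
  assumes "finite E"
    and "primeideal P (poly_ring E)"
    and "M = coordinate_matroid P E"
    and "circuit M C"
  shows "\<exists>\<theta> \<in> carrier (poly_ring C).
           P \<inter> carrier (poly_ring C) = PIdl\<^bsub>poly_ring C\<^esub> \<theta> \<and>
           (\<forall>\<theta>' \<in> carrier (poly_ring C).
              P \<inter> carrier (poly_ring C) = PIdl\<^bsub>poly_ring C\<^esub> \<theta>' \<longrightarrow>
              (\<exists>u. u \<noteq> 0 \<and> \<theta>' = const u * \<theta>))"
proof -
  interpret P: primeideal P "poly_ring E" by fact
  have carrier [simp]: "carrier (poly_ring S) = polys_in S" for S :: "'e set"
    by (simp add: poly_ring_def)
  have ops [simp]: "x \<otimes>\<^bsub>poly_ring S\<^esub> y = x * y" "x \<oplus>\<^bsub>poly_ring S\<^esub> y = x + y"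
      "\<zero>\<^bsub>poly_ring S\<^esub> = 0" "\<one>\<^bsub>poly_ring S\<^esub> = 1" for S and x y :: "('e, 'k) mpoly"
    by (simp_all add: poly_ring_def)
  have PIdl: "PIdl\<^bsub>poly_ring S\<^esub> x = {k * x | k. k \<in> polys_in S}" for S and x :: "('e, 'k) mpoly"
    by (simp add: cgenideal_def)
  have CE: "C \<subseteq> E" and dep: "P \<inter> polys_in C \<noteq> {0}"
    and indep: "\<And>D. D \<subset> C \<Longrightarrow> P \<inter> polys_in D = {0}"
    using assms(3,4) by (auto simp: circuit_def coordinate_matroid_def)
  have finC: "finite C" using CE assms(1) finite_subset by blast
  have sub: "polys_in C \<subseteq> (polys_in E :: ('e, 'k) mpoly set)" using CE by (rule polys_in_mono)
  have zero: "0 \<in> P" using additive_subgroup.zero_closed[OF P.is_additive_subgroup] by simp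
  have no_unit: "x \<notin> P" if "x dvd 1" for x
  proof
    assume x: "x \<in> P"
    from that obtain y where y: "x * y = 1" by (metis dvdE)
    then have "y dvd 1" by (metis dvd_triv_right)
    then have "\<one>\<^bsub>poly_ring E\<^esub> \<in> P"
      using P.I_r_closed[OF x, of y] y unit_in_polys_in[of y E] by simp
    then show False using P.one_imp_carrier P.I_notcarr by blast
  qed
  have "C \<noteq> {}"
  proof
    assume "C = {}"
    then obtain x where "x \<in> P" "x \<in> polys_in {}" "x \<noteq> 0" using dep zero polys_in_0 by blast
    then show False using no_unit[of x] by (metis mpoly_unit_iff polys_in_empty const_eq_0_iff)
  qed
  then obtain e where e: "e \<in> C" by blast
  let ?Q = "P \<inter> polys_in C"
  obtain f where f: "f \<in> ?Q" "f \<noteq> 0" "\<And>g. g \<in> ?Q \<Longrightarrow> f dvd g"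
  proof (rule prime_ideal_with_trivial_elimination_is_principal[of C e ?Q])
    show "a * q + b * r \<in> ?Q"
      if "a \<in> polys_in C" "b \<in> polys_in C" "q \<in> ?Q" "r \<in> ?Q" for a b q r
      using that sub P.I_l_closed[of q a] P.I_l_closed[of r b]
        additive_subgroup.a_closed[OF P.is_additive_subgroup, of "a * q" "b * r"]
      by (auto intro!: polys_in_plus polys_in_times)
    show "a \<in> ?Q \<or> b \<in> ?Q" if "a \<in> polys_in C" "b \<in> polys_in C" "a * b \<in> ?Q" for a b
      using that sub P.I_prime[of a b] by auto
    show "?Q \<inter> polys_in (C - {e}) = {0}"
      using indep[of "C - {e}"] e polys_in_mono[of "C - {e}" C] by blast
  qed (use finC e dep zero polys_in_0 in auto)
  have gen: "?Q = PIdl\<^bsub>poly_ring C\<^esub> f"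
    unfolding PIdl
  proof (intro equalityI subsetI)
    fix g assume g: "g \<in> ?Q"
    from f(3)[OF g] obtain k where k: "g = k * f" by (metis dvdE mult.commute)
    have "\<exists>k. g = k * f \<and> k \<in> polys_in C"
    proof (cases "g = 0")
      case True
      then show ?thesis using polys_in_0 by (intro exI[of _ 0]) auto
    next
      case False
      then show ?thesis using k g factor_in_polys_in[of k f C] by blast
    qed
    then show "g \<in> {k * f | k. k \<in> polys_in C}" by blast
  next
    fix g assume "g \<in> {k * f | k. k \<in> polys_in C}"
    then show "g \<in> ?Q"
      using f(1) sub P.I_l_closed[of f] by (auto intro: polys_in_times)
  qed
  have unique: "\<exists>u. u \<noteq> 0 \<and> \<theta>' = const u * f"
    if \<theta>': "\<theta>' \<in> polys_in C" "?Q = PIdl\<^bsub>poly_ring C\<^esub> \<theta>'" for \<theta>'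
  proof -
    have "\<theta>' = 1 * \<theta>'" by simp
    then have "\<theta>' \<in> ?Q" unfolding \<theta>'(2) PIdl using polys_in_1 by blast
    then obtain y where y: "\<theta>' = y * f" unfolding gen PIdl by blast
    have "f \<in> PIdl\<^bsub>poly_ring C\<^esub> \<theta>'" using f(1) \<theta>'(2) by simp
    then obtain x where x: "f = x * \<theta>'" unfolding PIdl by blast
    have "f * (y * x) = f * 1" using x y by (metis mult.assoc mult.commute mult_1_right)
    then have "y * x = 1" using mpoly_mult_left_cancel[OF f(2)] by blast
    then have "y dvd 1" by (metis dvd_triv_left)
    then show ?thesis using y by (auto simp: mpoly_unit_iff)
  qed
  show ?thesis
    using f(1) gen unique by (intro bexI[of _ f]) auto
qed

end
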